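(* Let $M,M_1,M_2\in\mathcal M$ and $r\in\{\beta,\beta\eta,h\}$. (1) If $M\rhd^*_rM_1$ and $M\rhd^*_rM_2$, then there is $M'$ such that $M_1\rhd^*_rM'$ and $M_2\rhd^*_rM'$. (2) $M_1\simeq_rM_2$ iff there is a term $M$ such that $M_1\rhd^*_rM$ and $M_2\rhd^*_rM$.
   Context: Indexes: finite sequences of natural numbers ($\mathcal L_{\mathbb N}$), $\oslash$ empty, $i::L$ prepending $i$, $L_1\preceq L_2$ (also $L_2\succeq L_1$) iff $L_2=L_1::L_3$ for some $L_3$ (concatenation). Terms: over a countably infinite set $\mathcal V$ of variables, terms $\mathcal M$, free indexed variables $\mathrm{fv}$, degree $d$, joinability $\diamond$ are defined simultaneously: $x^L\in\mathcal M$ ($\mathrm{fv}=\{x^L\}$, $d=L$); $MN\in\mathcal M$ when $d(M)\preceq d(N)$ and $M\diamond N$ ($\mathrm{fv}$ union, $d(MN)=d(M)$); $\lambda x^L.M\in\mathcal M$ when $L\succeq d(M)$ ($\mathrm{fv}(M)\setminus\{x^L\}$, $d=d(M)$). $M\diamond N$ iff whenever $x^L\in\mathrm{fv}(M)$, $x^K\in\mathrm{fv}(N)$ then $L=K$. Terms are modulo $\alpha$-conversion; capture-avoiding substitution $M[x^L:=N]$ is defined only if $M\diamond N$ and $d(N)=L$. A relation on $\mathcal M$ is compatible if it is preserved by $\lambda$-abstraction and by application on either side whenever the resulting expressions are terms. $\rhd_\beta$: least compatible relation containing $(\lambda x^L.M)N\rhd_\beta M[x^L:=N]$ when $d(N)=L$;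 $\rhd_\eta$: least compatible relation containing $\lambda x^L.(Mx^L)\rhd_\eta M$ when $x^L\notin\mathrm{fv}(M)$; $\rhd_{\beta\eta}=\rhd_\beta\cup\rhd_\eta$; weak head reduction $(\lambda x^L.M)NN_1\dots N_n\rhd_h M[x^L:=N]N_1\dots N_n$ ($n\ge0$). $\rhd^*_r$ is the reflexive–transitive closure of $\rhd_r$, and $\simeq_r$ the equivalence relation induced by $\rhd^*_r$. *)

theory Defs
  imports Main "HOL-Library.Sublist" "HOL-Library.Countable" "HOL-Library.Infinite_Typeclass"
begin

type_synonym index = "nat list"

text \<open>The pair \<open>(x, L)\<close> is the indexed variable \<open>x\<^sup>L\<close>.\<close>

type_synonym 'v ivar = "'v \<times> index"


section \<open>Raw named terms and alpha-conversion\<close>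

datatype 'v raw = RVar "'v ivar" | RApp "'v raw" "'v raw" | RLam "'v ivar" "'v raw"

primrec rfv :: "'v raw \<Rightarrow> 'v ivar set" where
  "rfv (RVar a) = {a}"
| "rfv (RApp M N) = rfv M \<union> rfv N"
| "rfv (RLam a M) = rfv M - {a}"

primrec rvars :: "'v raw \<Rightarrow> 'v ivar set" where
  "rvars (RVar a) = {a}"
| "rvars (RApp M N) = rvars M \<union> rvars N"
| "rvars (RLam a M) = insert a (rvars M)"

primrec rdeg :: "'v raw \<Rightarrow> index" where
  "rdeg (RVar a) = snd a"
| "rdeg (RApp M N) = rdeg M"
| "rdeg (RLam a M) = rdeg M"

primrec rename :: "'v ivar \<Rightarrow> 'v ivar \<Rightarrow> 'v raw \<Rightarrow> 'v raw" where
  "rename a b (RVar c) = RVar (if c = a then b else c)"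
| "rename a b (RApp M N) = RApp (rename a b M) (rename a b N)"
| "rename a b (RLam c M) = RLam c (if c = a then M else rename a b M)"

text \<open>A bound \<open>x\<^sup>L\<close> may be renamed to \<open>y\<^sup>L\<close>, with the same index, when \<open>y\<^sup>L\<close> does not occur
  in the body; then \<^const>\<open>rename\<close> cannot capture.\<close>

inductive alpha :: "'v raw \<Rightarrow> 'v raw \<Rightarrow> bool" where
  alpha_rename: "(y, L) \<notin> rvars M \<Longrightarrow>
    alpha (RLam (x, L) M) (RLam (y, L) (rename (x, L) (y, L) M))"
| alpha_App: "alpha M M' \<Longrightarrow> alpha N N' \<Longrightarrow> alpha (RApp M N) (RApp M' N')"
| alpha_Lam: "alpha M M' \<Longrightarrow> alpha (RLam a M) (RLam a M')"
| alpha_refl: "alpha M M"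
| alpha_sym: "alpha M N \<Longrightarrow> alpha N M"
| alpha_trans: "alpha M N \<Longrightarrow> alpha N P \<Longrightarrow> alpha M P"

lemma rfv_subset_rvars: "rfv M \<subseteq> rvars M"
  by (induction M) auto

lemma finite_rvars: "finite (rvars M)"
  by (induction M) auto

lemma finite_rfv: "finite (rfv M)"
  using rfv_subset_rvars finite_rvars by (rule finite_subset)

lemma rfv_rename:
  "b \<notin> rvars M \<Longrightarrow> rfv (rename a b M) = (if a \<in> rfv M then insert b (rfv M - {a}) else rfv M)"
  by (induction M) (auto dest: subsetD[OF rfv_subset_rvars])

lemma rdeg_rename: "snd a = snd b \<Longrightarrow> rdeg (rename a b M) = rdeg M"
  by (induction M) auto

lemma alpha_rfv: "alpha M N \<Longrightarrow> rfv M = rfv N"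
  by (induction rule: alpha.induct) (auto simp: rfv_rename dest: subsetD[OF rfv_subset_rvars])

lemma alpha_rdeg: "alpha M N \<Longrightarrow> rdeg M = rdeg N"
  by (induction rule: alpha.induct) (auto simp: rdeg_rename)


section \<open>Capture-avoiding substitution on raw terms\<close>

text \<open>Simultaneous substitution in which every binder is renamed to a variable of the same index
  that is not free in any of the terms substituted for the free variables of the abstraction. The
  new binder depends only on that set of variables, so alpha-equivalent terms are sent to the same
  raw term.\<close>

definition fresh_var :: "'v ivar set \<Rightarrow> index \<Rightarrow> 'v ivar" where
  "fresh_var S L = ((SOME z. (z, L) \<notin> S), L)"

primrec rsubst :: "('v ivar \<Rightarrow> 'v raw) \<Rightarrow> 'v raw \<Rightarrow> 'v raw" where
  "rsubst \<sigma> (RVar a) = \<sigma> a"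
| "rsubst \<sigma> (RApp M N) = RApp (rsubst \<sigma> M) (rsubst \<sigma> N)"
| "rsubst \<sigma> (RLam a M) =
    (let b = fresh_var (\<Union>c \<in> rfv M - {a}. rfv (\<sigma> c)) (snd a)
     in RLam b (rsubst (\<sigma>(a := RVar b)) M))"

lemma rsubst_cong: "(\<And>c. c \<in> rfv M \<Longrightarrow> \<sigma> c = \<tau> c) \<Longrightarrow> rsubst \<sigma> M = rsubst \<tau> M"
proof (induction M arbitrary: \<sigma> \<tau>)
  case (RLam a M)
  have "(\<Union>c \<in> rfv M - {a}. rfv (\<sigma> c)) = (\<Union>c \<in> rfv M - {a}. rfv (\<tau> c))"
    using RLam.prems by auto
  moreover have "rsubst (\<sigma>(a := RVar b)) M = rsubst (\<tau>(a := RVar b)) M" for b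
    using RLam.prems by (intro RLam.IH) auto
  ultimately show ?case by simp
next
  case (RApp M N)
  have "rsubst \<sigma> M = rsubst \<tau> M" "rsubst \<sigma> N = rsubst \<tau> N"
    using RApp.prems by (auto intro!: RApp.IH)
  then show ?case by simp
qed simp

lemma rsubst_rename:
  "b \<notin> rvars M \<Longrightarrow> rsubst \<sigma> (rename a b M) = rsubst (\<sigma>(a := \<sigma> b)) M"
proof (induction M arbitrary: \<sigma>)
  case (RLam c M)
  show ?case
  proof (cases "c = a")
    case True
    have "(\<Union>d \<in> rfv M - {a}. rfv (\<sigma> d)) = (\<Union>d \<in> rfv M - {a}. rfv ((\<sigma>(a := \<sigma> b)) d))"
      by auto
    with True show ?thesis by (simp only: rename.simps rsubst.simps if_True simp_thms fun_upd_upd)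
  next
    case False
    have bc: "b \<noteq> c" "b \<notin> rvars M" "b \<notin> rfv M"
      using RLam.prems rfv_subset_rvars[of M] by auto
    have "(\<Union>d \<in> rfv (rename a b M) - {c}. rfv (\<sigma> d))
        = (\<Union>d \<in> rfv M - {c}. rfv ((\<sigma>(a := \<sigma> b)) d))"
      using bc False by (auto simp: rfv_rename split: if_splits)
    moreover have "rsubst (\<sigma>(c := t)) (rename a b M) = rsubst (\<sigma>(a := \<sigma> b, c := t)) M" for t
      using RLam.IH[OF bc(2), of "\<sigma>(c := t)"] bc(1) False
      by (simp only: fun_upd_twist[OF False] fun_upd_other[OF bc(1)])
    ultimately show ?thesis
      using False by (simp only: rename.simps rsubst.simps if_False)
  qed
qed auto

lemma alpha_rsubst_eq: "alpha M N \<Longrightarrow> rsubst \<sigma> M = rsubst \<sigma> N"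
proof (induction arbitrary: \<sigma> rule: alpha.induct)
  case (alpha_rename y L M x)
  let ?a = "(x, L)" and ?b = "(y, L)"
  have nb: "?b \<notin> rfv M" using alpha_rename subsetD[OF rfv_subset_rvars] by blast
  have "rfv (rename ?a ?b M) - {?b} = rfv M - {?a}"
    using alpha_rename nb by (auto simp: rfv_rename)
  moreover have "rsubst (\<sigma>(?b := t)) (rename ?a ?b M) = rsubst (\<sigma>(?a := t)) M" for t
    unfolding rsubst_rename[OF alpha_rename] using nb by (intro rsubst_cong) auto
  ultimately show ?case by simp
next
  case (alpha_Lam M M' a)
  show ?case by (simp only: rsubst.simps alpha_rfv[OF alpha_Lam.hyps] alpha_Lam.IH)
qed auto

lemma alpha_rsubst_env: "(\<And>c. alpha (\<sigma> c) (\<tau> c)) \<Longrightarrow> alpha (rsubst \<sigma> M) (rsubst \<tau> M)"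
proof (induction M arbitrary: \<sigma> \<tau>)
  case (RLam a M)
  have "rfv (\<sigma> c) = rfv (\<tau> c)" for c
    by (rule alpha_rfv[OF RLam.prems])
  then show ?case
    by (auto simp: Let_def RLam.prems intro!: alpha_Lam RLam.IH intro: alpha_refl)
qed (auto intro: alpha_App)

lemma fresh_var_notin:
  assumes "finite (S :: ('v::infinite) ivar set)"
  shows "fresh_var S L \<notin> S" "snd (fresh_var S L) = L"
proof -
  have "finite (fst ` S)" using assms by simp
  then obtain z where "z \<notin> fst ` S" using ex_new_if_finite infinite_UNIV by blast
  then have "(z, L) \<notin> S" by force
  then show "fresh_var S L \<notin> S" unfolding fresh_var_def by (rule someI)
qed (simp add: fresh_var_def)

lemma rfv_rsubst: "rfv (rsubst \<sigma> M) = (\<Union>c \<in> rfv M. rfv (\<sigma> c))"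
  for M :: "('v::infinite) raw"
proof (induction M arbitrary: \<sigma>)
  case (RLam a M)
  define b where "b = fresh_var (\<Union>c \<in> rfv M - {a}. rfv (\<sigma> c)) (snd a)"
  have "b \<notin> (\<Union>c \<in> rfv M - {a}. rfv (\<sigma> c))"
    unfolding b_def by (rule fresh_var_notin) (simp add: finite_rfv)
  then have "(\<Union>c \<in> rfv M. rfv ((\<sigma>(a := RVar b)) c)) - {b} = (\<Union>c \<in> rfv M - {a}. rfv (\<sigma> c))"
    by (auto split: if_splits)
  then show ?case by (simp only: rsubst.simps rfv.simps Let_def b_def[symmetric] RLam.IH)
qed auto

lemma rsubst_rsubst: "rsubst \<tau> (rsubst \<sigma> M) = rsubst (\<lambda>c. rsubst \<tau> (\<sigma> c)) M"
  for M :: "('v::infinite) raw"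
proof (induction M arbitrary: \<sigma> \<tau>)
  case (RLam a M)
  define b where "b = fresh_var (\<Union>c \<in> rfv M - {a}. rfv (\<sigma> c)) (snd a)"
  have b: "b \<notin> (\<Union>c \<in> rfv M - {a}. rfv (\<sigma> c))" "snd b = snd a"
    unfolding b_def by (rule fresh_var_notin, simp add: finite_rfv)+
  have "rfv (rsubst (\<sigma>(a := RVar b)) M) - {b} = (\<Union>c \<in> rfv M - {a}. rfv (\<sigma> c))"
    using b by (auto simp: rfv_rsubst split: if_splits)
  then have S: "(\<Union>c \<in> rfv (rsubst (\<sigma>(a := RVar b)) M) - {b}. rfv (\<tau> c))
      = (\<Union>c \<in> rfv M - {a}. rfv (rsubst \<tau> (\<sigma> c)))"
    by (auto simp: rfv_rsubst)
  have "rsubst (\<tau>(b := t)) (rsubst (\<sigma>(a := RVar b)) M)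
      = rsubst ((\<lambda>c. rsubst \<tau> (\<sigma> c))(a := t)) M" for t
    unfolding RLam.IH using b by (auto intro!: rsubst_cong)
  then show ?case
    by (simp only: rsubst.simps Let_def b_def[symmetric] S b)
qed auto

primrec rsize :: "'v raw \<Rightarrow> nat" where
  "rsize (RVar a) = 0"
| "rsize (RApp M N) = Suc (rsize M + rsize N)"
| "rsize (RLam a M) = Suc (rsize M)"

lemma rsize_rename: "rsize (rename a b M) = rsize M"
  by (induction M) auto

lemma alpha_rsubst_id: "alpha M (rsubst RVar M)"
  for M :: "('v::infinite) raw"
proof (induction "rsize M" arbitrary: M rule: less_induct)
  case less
  show ?case
  proof (cases M)
    case (RLam a N)
    define b where "b = fresh_var (\<Union>c \<in> rfv N - {a}. rfv (RVar c)) (snd a)"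
    have b: "b \<notin> rfv N - {a}" "snd b = snd a"
      unfolding b_def using fresh_var_notin[of "rfv N - {a}"] by (auto simp: finite_rfv)
    define P where "P = rsubst (RVar(a := RVar b)) N"
    define d where "d = fresh_var (rvars N \<union> rvars P) (snd a)"
    have d: "d \<notin> rvars N \<union> rvars P" "snd d = snd a"
      unfolding d_def by (rule fresh_var_notin, simp add: finite_rvars)+
    have step: "alpha (RLam e Q) (RLam d (rsubst (RVar(e := RVar d)) Q))"
      if "rsize Q < rsize M" "d \<notin> rvars Q" "snd d = snd e" for e Q
    proof -
      have "alpha (RLam e Q) (RLam d (rename e d Q))"
        using alpha_rename[of "fst d" "snd d" Q "fst e"] that by (metis prod.collapse)
      moreover have "alpha (rename e d Q) (rsubst RVar (rename e d Q))"
        using that by (intro less) (simp add: rsize_rename)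
      ultimately show ?thesis
        using that by (metis alpha_Lam alpha_trans rsubst_rename)
    qed
    have sP: "rsize P = rsize N"
    proof -
      have "rsize (rsubst \<sigma> N) = rsize N" if "\<forall>c. \<exists>e. \<sigma> c = RVar e" for \<sigma> :: "'v ivar \<Rightarrow> 'v raw"
        using that by (induction N arbitrary: \<sigma>) (auto simp: Let_def, metis rsize.simps(1))
      then show ?thesis unfolding P_def by simp
    qed
    have "alpha (RLam a N) (RLam d (rsubst (RVar(a := RVar d)) N))"
      using d RLam by (intro step) auto
    moreover have "rsubst (RVar(b := RVar d)) P = rsubst (RVar(a := RVar d)) N"
      unfolding P_def rsubst_rsubst using b by (auto intro!: rsubst_cong)
    moreover have "alpha (RLam b P) (RLam d (rsubst (RVar(b := RVar d)) P))"
      using d RLam sP b by (intro step) auto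
    ultimately have "alpha (RLam a N) (RLam b P)"
      by (metis alpha_sym alpha_trans)
    then show ?thesis unfolding RLam by (simp add: Let_def b_def P_def)
  next
    case (RApp P Q)
    have "alpha P (rsubst RVar P)" "alpha Q (rsubst RVar Q)"
      using RApp by (auto intro!: less)
    then show ?thesis unfolding RApp by (simp add: alpha_App)
  qed (simp add: alpha_refl)
qed

lemma alpha_iff_rsubst_id: "alpha M N \<longleftrightarrow> rsubst RVar M = rsubst RVar N"
  for M N :: "('v::infinite) raw"
  by (metis alpha_rsubst_eq alpha_rsubst_id alpha_sym alpha_trans)

lemma alpha_RLam_fresh:
  fixes M :: "('v::infinite) raw"
  assumes "b \<notin> (\<Union>c \<in> rfv M - {a}. rfv (\<sigma> c))" "snd b = snd a"
  shows "alpha (rsubst \<sigma> (RLam a M)) (RLam b (rsubst (\<sigma>(a := RVar b)) M))"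
proof -
  have "rfv (rsubst (\<sigma>(a := RVar b)) M) - {b} = (\<Union>c \<in> rfv M - {a}. rfv (\<sigma> c))"
    using assms by (auto simp: rfv_rsubst split: if_splits)
  then have S: "(\<Union>c \<in> rfv (rsubst (\<sigma>(a := RVar b)) M) - {b}. rfv (RVar c))
      = (\<Union>c \<in> rfv M - {a}. rfv (rsubst RVar (\<sigma> c)))"
    by (auto simp: rfv_rsubst)
  have "rsubst (RVar(b := t)) (rsubst (\<sigma>(a := RVar b)) M)
      = rsubst ((\<lambda>c. rsubst RVar (\<sigma> c))(a := t)) M" for t
    unfolding rsubst_rsubst using assms by (auto intro!: rsubst_cong)
  then have "rsubst RVar (RLam b (rsubst (\<sigma>(a := RVar b)) M))
      = rsubst (\<lambda>c. rsubst RVar (\<sigma> c)) (RLam a M)"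
    by (simp only: rsubst.simps Let_def S assms(2))
  then show ?thesis by (simp only: alpha_iff_rsubst_id rsubst_rsubst)
qed


section \<open>Expressions modulo alpha-conversion\<close>

quotient_type 'v trm = "'v raw" / alpha
  by (intro equivpI reflpI sympI transpI) (blast intro: alpha_refl alpha_sym alpha_trans)+

lift_definition Var :: "'v ivar \<Rightarrow> 'v trm" is RVar .

lift_definition App :: "'v trm \<Rightarrow> 'v trm \<Rightarrow> 'v trm" is RApp
  by (rule alpha_App)

lift_definition Lam :: "'v ivar \<Rightarrow> 'v trm \<Rightarrow> 'v trm" is RLam
  by (rule alpha_Lam)

lift_definition fv :: "'v trm \<Rightarrow> 'v ivar set" is rfv
  by (rule alpha_rfv)

lift_definition deg :: "'v trm \<Rightarrow> index" is rdeg
  by (rule alpha_rdeg)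

lift_definition subst :: "'v trm \<Rightarrow> 'v ivar \<Rightarrow> 'v trm \<Rightarrow> 'v trm" ("_[_ ::= _]" [1000, 0, 0] 1000)
  is "\<lambda>M a N. rsubst (RVar(a := N)) M"
proof -
  fix M M' N N' :: "'v raw" and a
  assume "alpha M M'" "alpha N N'"
  have "rsubst (RVar(a := N)) M = rsubst (RVar(a := N)) M'"
    by (rule alpha_rsubst_eq) fact
  moreover have "alpha (rsubst (RVar(a := N)) M') (rsubst (RVar(a := N')) M')"
    using \<open>alpha N N'\<close> by (intro alpha_rsubst_env) (simp add: alpha_refl)
  ultimately show "alpha (rsubst (RVar(a := N)) M) (rsubst (RVar(a := N')) M')" by simp
qed

lemma fv_simps [simp]:
  "fv (Var a) = {a}"
  "fv (App M N) = fv M \<union> fv N"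
  "fv (Lam a M) = fv M - {a}"
  by (transfer, simp)+

lemma deg_simps [simp]:
  "deg (Var a) = snd a"
  "deg (App M N) = deg M"
  "deg (Lam a M) = deg M"
  by (transfer, simp)+

lemma subst_Var: "(Var b)[a ::= N] = (if b = a then N else Var b)"
  by transfer (simp add: alpha_refl)

lemma subst_App: "(App M P)[a ::= N] = App (M[a ::= N]) (P[a ::= N])"
  by transfer (simp add: alpha_refl)

lemma subst_Lam:
  fixes M N :: "('v::infinite) trm"
  assumes "b \<noteq> a" "b \<notin> fv N"
  shows "(Lam b M)[a ::= N] = Lam b (M[a ::= N])"
  using assms
proof transfer
  fix a b and M N :: "'v raw"
  assume *: "b \<noteq> a" "b \<notin> rfv N"
  have "alpha (rsubst (RVar(a := N)) (RLam b M)) (RLam b (rsubst (RVar(a := N, b := RVar b)) M))"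
    using * by (intro alpha_RLam_fresh) auto
  moreover have "rsubst (RVar(a := N, b := RVar b)) M = rsubst (RVar(a := N)) M"
    using * by (intro rsubst_cong) auto
  ultimately show "alpha (rsubst (RVar(a := N)) (RLam b M)) (RLam b (rsubst (RVar(a := N)) M))"
    by simp
qed

lemma Lam_rename:
  fixes M :: "('v::infinite) trm"
  assumes "(y, L) \<notin> fv M"
  shows "Lam (x, L) M = Lam (y, L) (M[(x, L) ::= Var (y, L)])"
  using assms
proof transfer
  fix x y :: 'v and L and M :: "'v raw"
  assume "(y, L) \<notin> rfv M"
  then have "alpha (rsubst RVar (RLam (x, L) M))
      (RLam (y, L) (rsubst (RVar((x, L) := RVar (y, L))) M))"
    by (intro alpha_RLam_fresh) auto
  then show "alpha (RLam (x, L) M) (RLam (y, L) (rsubst (RVar((x, L) := RVar (y, L))) M))"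
    by (rule alpha_trans[OF alpha_rsubst_id])
qed


section \<open>Terms\<close>

definition joinable :: "'v trm \<Rightarrow> 'v trm \<Rightarrow> bool" (infix "\<diamondop>" 50) where
  "M \<diamondop> N \<longleftrightarrow> (\<forall>x L K. (x, L) \<in> fv M \<longrightarrow> (x, K) \<in> fv N \<longrightarrow> L = K)"

text \<open>The order \<open>\<preceq>\<close> on indexes is \<^const>\<open>prefix\<close>. An expression belongs to \<open>\<M>\<close> if some raw
  representative of it is built by the rules.\<close>

inductive_set terms :: "'v trm set" ("\<M>") where
  Var: "Var (x, L) \<in> \<M>"
| App: "M \<in> \<M> \<Longrightarrow> N \<in> \<M> \<Longrightarrow> prefix (deg M) (deg N) \<Longrightarrow> M \<diamondop> N \<Longrightarrow> App M N \<in> \<M>"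
| Lam: "M \<in> \<M> \<Longrightarrow> prefix (deg M) L \<Longrightarrow> Lam (x, L) M \<in> \<M>"


section \<open>Reduction\<close>

inductive compatible_closure :: "('v trm \<Rightarrow> 'v trm \<Rightarrow> bool) \<Rightarrow> 'v trm \<Rightarrow> 'v trm \<Rightarrow> bool" for R where
  base: "R M N \<Longrightarrow> compatible_closure R M N"
| lam: "compatible_closure R M N \<Longrightarrow> Lam (x, L) M \<in> \<M> \<Longrightarrow> Lam (x, L) N \<in> \<M> \<Longrightarrow>
    compatible_closure R (Lam (x, L) M) (Lam (x, L) N)"
| app_left: "compatible_closure R M N \<Longrightarrow> App M P \<in> \<M> \<Longrightarrow> App N P \<in> \<M> \<Longrightarrow>
    compatible_closure R (App M P) (App N P)"
| app_right: "compatible_closure R M N \<Longrightarrow> App P M \<in> \<M> \<Longrightarrow> App P N \<in> \<M> \<Longrightarrow>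
    compatible_closure R (App P M) (App P N)"

text \<open>The constant \<^const>\<open>subst\<close> is total. The premises \<open>M \<diamondop> N\<close> and \<open>deg N = L\<close> of the
  rules below are the conditions under which \<open>M[x\<^sup>L := N]\<close> is defined. As expressions are taken
  modulo alpha-conversion, \<open>M \<diamondop> N\<close> can always be achieved by renaming \<open>x\<close>.\<close>

inductive beta_redex :: "'v trm \<Rightarrow> 'v trm \<Rightarrow> bool" where
  "App (Lam (x, L) M) N \<in> \<M> \<Longrightarrow> M \<diamondop> N \<Longrightarrow> deg N = L \<Longrightarrow>
    beta_redex (App (Lam (x, L) M) N) (M[(x, L) ::= N])"

inductive eta_redex :: "'v trm \<Rightarrow> 'v trm \<Rightarrow> bool" where
  "Lam (x, L) (App M (Var (x, L))) \<in> \<M> \<Longrightarrow> (x, L) \<notin> fv M \<Longrightarrow>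
    eta_redex (Lam (x, L) (App M (Var (x, L)))) M"

definition beta :: "'v trm \<Rightarrow> 'v trm \<Rightarrow> bool" where
  "beta = compatible_closure beta_redex"

definition eta :: "'v trm \<Rightarrow> 'v trm \<Rightarrow> bool" where
  "eta = compatible_closure eta_redex"

definition beta_eta :: "'v trm \<Rightarrow> 'v trm \<Rightarrow> bool" where
  "beta_eta M N \<longleftrightarrow> beta M N \<or> eta M N"

inductive weak_head :: "'v trm \<Rightarrow> 'v trm \<Rightarrow> bool" where
  "foldl App (App (Lam (x, L) M) N) Ns \<in> \<M> \<Longrightarrow> M \<diamondop> N \<Longrightarrow> deg N = L \<Longrightarrow>
    weak_head (foldl App (App (Lam (x, L) M) N) Ns) (foldl App (M[(x, L) ::= N]) Ns)"

definition conv :: "('v trm \<Rightarrow> 'v trm \<Rightarrow> bool) \<Rightarrow> 'v trm \<Rightarrow> 'v trm \<Rightarrow> bool" where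
  "conv r = equivclp (r\<^sup>*\<^sup>*)"

end

theory Submission
  imports Defs "HOL-Library.Confluence"
begin

text \<open>A Tait--Martin-Loef argument, carried out on all expressions and then restricted to \<open>\<M>\<close>.
  Contraction of a redex preserves the degree of any expression, so the condition on degrees in a
  beta-redex survives reduction, and joinability and the order on indexes play no role for the diamond
  property of parallel reduction. One-step reduction keeps the degree and does not enlarge the set of
  free variables, hence stays inside \<open>\<M>\<close>, where parallel and ordinary reduction have the same
  reflexive-transitive closure. Weak head reduction is deterministic.\<close>

section \<open>Simultaneous substitution\<close>

text \<open>\<open>alpha_rsubst_env\<close> asks for equivalence at every variable. Patching
  \<open>\<tau>\<close> with \<open>\<sigma>\<close> off the free variables of \<open>M\<close>
  provides it without changing the result.\<close>

lemma alpha_rsubst_cong: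
  assumes "\<And>c. c \<in> rfv M \<Longrightarrow> alpha (\<sigma> c) (\<tau> c)"
  shows "alpha (rsubst \<sigma> M) (rsubst \<tau> M)"
proof -
  let ?\<tau> = "\<lambda>c. if c \<in> rfv M then \<tau> c else \<sigma> c"
  have "alpha (rsubst \<sigma> M) (rsubst ?\<tau> M)"
    using assms by (intro alpha_rsubst_env) (auto intro: alpha_refl)
  moreover have "rsubst ?\<tau> M = rsubst \<tau> M" by (intro rsubst_cong) auto
  ultimately show ?thesis by simp
qed

lemma rdeg_rsubst: "(\<And>c. c \<in> rfv M \<Longrightarrow> rdeg (\<sigma> c) = snd c) \<Longrightarrow> rdeg (rsubst \<sigma> M) = rdeg M"
proof (induction M arbitrary: \<sigma>)
  case (RLam a M)
  have "rdeg (rsubst (\<sigma>(a := RVar b)) M) = rdeg M" if "snd b = snd a" for b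
    using RLam.prems that by (intro RLam.IH) auto
  then show ?case by (simp add: Let_def fresh_var_def)
qed auto

lemma alpha_rsize: "alpha M N \<Longrightarrow> rsize M = rsize N"
  by (induction rule: alpha.induct) (auto simp: rsize_rename)

text \<open>Induction measure: unlike structural induction on a representative, it lets the
  induction hypothesis apply to a body whose bound variable has been renamed.\<close>

lift_definition tsize :: "'v trm \<Rightarrow> nat" is rsize
  by (rule alpha_rsize)

text \<open>Composites of simultaneous substitutions are again simultaneous
  (\<open>psubst_psubst\<close>), so laws for nested substitutions reduce, by
  \<open>psubst_cong\<close>, to a comparison on variables.\<close>

lift_definition psubst :: "('v ivar \<Rightarrow> 'v trm) \<Rightarrow> 'v trm \<Rightarrow> 'v trm" is rsubst
proof -
  fix \<sigma> \<tau> :: "'v ivar \<Rightarrow> 'v raw" and M N :: "'v raw"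
  assume "\<And>c. alpha (\<sigma> c) (\<tau> c)" "alpha M N"
  then show "alpha (rsubst \<sigma> M) (rsubst \<tau> N)"
    using alpha_rsubst_eq[of M N \<sigma>] alpha_rsubst_env[of \<sigma> \<tau> N] by simp
qed

lemma tsize_simps [simp]:
  "tsize (Var a) = 0"
  "tsize (App M N) = Suc (tsize M + tsize N)"
  "tsize (Lam a M) = Suc (tsize M)"
  by (transfer, simp)+

lemma trm_induct [case_names Var App Lam]:
  assumes "\<And>a. P (Var a)" "\<And>M N. P M \<Longrightarrow> P N \<Longrightarrow> P (App M N)" "\<And>a M. P M \<Longrightarrow> P (Lam a M)"
  shows "P M"
proof (induction M)
  case (1 R)
  show ?case
  proof (induction R)
    case (RVar a) show ?case using assms(1) by (simp add: Var.abs_eq)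
  next
    case (RApp M N) then show ?case using assms(2) by (simp add: App.abs_eq[symmetric])
  next
    case (RLam a M) then show ?case using assms(3) by (simp add: Lam.abs_eq[symmetric])
  qed
qed

lemma trm_cases [case_names Var App Lam]:
  obtains a where "M = Var a" | P N where "M = App P N" | a P where "M = Lam a P"
  by (induction M rule: trm_induct) auto

lemma finite_fv [simp]: "finite (fv M)"
  by transfer (rule finite_rfv)

lemma psubst_Var [simp]: "psubst \<sigma> (Var a) = \<sigma> a"
  by transfer (simp add: alpha_refl)

lemma psubst_App [simp]: "psubst \<sigma> (App M N) = App (psubst \<sigma> M) (psubst \<sigma> N)"
  by transfer (simp add: alpha_refl)

text \<open>The canonical binder chosen by \<open>rsubst\<close> is replaced by any sufficiently
  fresh one, so that later proofs can choose a binder serving several terms at once.\<close>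

lemma psubst_Lam:
  fixes M :: "('v::infinite) trm"
  assumes "b \<notin> (\<Union>c \<in> fv M - {a}. fv (\<sigma> c))" "snd b = snd a"
  shows "psubst \<sigma> (Lam a M) = Lam b (psubst (\<sigma>(a := Var b)) M)"
  using assms by transfer (rule alpha_RLam_fresh)

lemma psubst_cong: "(\<And>c. c \<in> fv M \<Longrightarrow> \<sigma> c = \<tau> c) \<Longrightarrow> psubst \<sigma> M = psubst \<tau> M"
  by transfer (rule alpha_rsubst_cong)

lemma psubst_id: "psubst Var M = M" for M :: "('v::infinite) trm"
  by transfer (rule alpha_sym[OF alpha_rsubst_id])

lemma psubst_eq_self: "(\<And>c. c \<in> fv M \<Longrightarrow> \<sigma> c = Var c) \<Longrightarrow> psubst \<sigma> M = M"
  for M :: "('v::infinite) trm"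
  using psubst_cong[of M \<sigma> Var] by (simp add: psubst_id)

lemma psubst_psubst: "psubst \<tau> (psubst \<sigma> M) = psubst (\<lambda>c. psubst \<tau> (\<sigma> c)) M"
  for M :: "('v::infinite) trm"
  by transfer (simp add: rsubst_rsubst alpha_refl)

lemma fv_psubst: "fv (psubst \<sigma> M) = (\<Union>c \<in> fv M. fv (\<sigma> c))"
  for M :: "('v::infinite) trm"
  by transfer (rule rfv_rsubst)

lemma deg_psubst: "(\<And>c. c \<in> fv M \<Longrightarrow> deg (\<sigma> c) = snd c) \<Longrightarrow> deg (psubst \<sigma> M) = deg M"
  by transfer (rule rdeg_rsubst)

lemma subst_eq_psubst: "M[a ::= N] = psubst (Var(a := N)) M"
  by transfer (rule alpha_refl)

lemma psubst_subst: "psubst \<tau> (M[a ::= N]) = psubst (\<tau>(a := psubst \<tau> N)) M"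
  for M :: "('v::infinite) trm"
  unfolding subst_eq_psubst psubst_psubst by (rule psubst_cong) simp

lemma subst_psubst:
  fixes M :: "('v::infinite) trm"
  assumes "b \<notin> (\<Union>c \<in> fv M - {a}. fv (\<sigma> c))"
  shows "(psubst (\<sigma>(a := Var b)) M)[b ::= N] = psubst (\<sigma>(a := N)) M"
  unfolding subst_eq_psubst psubst_psubst
proof (rule psubst_cong)
  fix c assume "c \<in> fv M"
  then have "psubst (Var(b := N)) (\<sigma> c) = \<sigma> c" if "c \<noteq> a"
    using assms that by (intro psubst_eq_self) auto
  then show "psubst (Var(b := N)) ((\<sigma>(a := Var b)) c) = (\<sigma>(a := N)) c" by simp
qed

lemma subst_rename_subst:
  fixes M :: "('v::infinite) trm"
  assumes "b \<notin> fv M - {a}"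
  shows "(M[a ::= Var b])[b ::= N] = M[a ::= N]"
  using subst_psubst[where \<sigma> = Var and b = b and M = M and a = a and N = N] assms by (simp add: subst_eq_psubst)

lemma subst_fresh:
  fixes M :: "('v::infinite) trm"
  assumes "a \<notin> fv M"
  shows "M[a ::= N] = M"
  unfolding subst_eq_psubst using assms by (intro psubst_eq_self) auto

lemma subst_self: "M[a ::= Var a] = M" for M :: "('v::infinite) trm"
  by (simp add: subst_eq_psubst psubst_id)

lemma fv_subst: "fv (M[a ::= N]) = (fv M - {a}) \<union> (if a \<in> fv M then fv N else {})"
  for M :: "('v::infinite) trm"
  unfolding subst_eq_psubst fv_psubst by (auto split: if_splits)

lemma deg_subst: "deg N = snd a \<Longrightarrow> deg (M[a ::= N]) = deg M"
  unfolding subst_eq_psubst by (rule deg_psubst) auto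


section \<open>Freeness of the constructors modulo alpha-conversion\<close>

lemma trm_distinct [simp]:
  fixes M N P :: "('v::infinite) trm"
  shows "Var a \<noteq> App M N" "App M N \<noteq> Var a" "Var a \<noteq> Lam b M" "Lam b M \<noteq> Var a"
    "App M N \<noteq> Lam b P" "Lam b P \<noteq> App M N"
  by (transfer, simp add: alpha_iff_rsubst_id Let_def)+

lemma App_inject [simp]: "App M N = App M' N' \<longleftrightarrow> M = M' \<and> N = N'"
  for M N :: "('v::infinite) trm"
  by transfer (simp add: alpha_iff_rsubst_id)

text \<open>\<open>rsubst RVar\<close> sends alpha-equivalent raw terms to the same raw term. Its
  outermost binder is determined by the free variables and the index of the abstraction, and is the
  witness \<open>b\<close>.\<close>

lemma Lam_eq_common_rename:
  fixes M M' :: "('v::infinite) trm"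
  assumes "Lam a M = Lam a' M'"
  shows "\<exists>b. b \<notin> fv M - {a} \<and> b \<notin> fv M' - {a'} \<and> snd a = snd a' \<and>
    M[a ::= Var b] = M'[a' ::= Var b]"
  using assms
proof transfer
  fix a a' and M M' :: "'v raw"
  let ?b = "\<lambda>a M :: 'v raw. fresh_var (rfv M - {a}) (snd a)"
  assume "alpha (RLam a M) (RLam a' M')"
  then have eq: "?b a M = ?b a' M'"
    "rsubst (RVar(a := RVar (?b a M))) M = rsubst (RVar(a' := RVar (?b a' M'))) M'"
    unfolding alpha_iff_rsubst_id by (auto simp: Let_def)
  have "snd a = snd a'"
    using arg_cong[OF eq(1), of snd] by (simp add: fresh_var_def)
  moreover have "?b a M \<notin> rfv M - {a}" "?b a' M' \<notin> rfv M' - {a'}"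
    by (rule fresh_var_notin, simp add: finite_rfv)+
  ultimately show "\<exists>b. b \<notin> rfv M - {a} \<and> b \<notin> rfv M' - {a'} \<and> snd a = snd a' \<and>
    alpha (rsubst (RVar(a := RVar b)) M) (rsubst (RVar(a' := RVar b)) M')"
    using eq alpha_refl[of "rsubst (RVar(a := RVar (?b a M))) M"]
    by (intro exI[of _ "?b a M"]) simp
qed

lemma Lam_eqD:
  fixes M M' :: "('v::infinite) trm"
  assumes "Lam a M = Lam a' M'"
  shows "snd a = snd a'" "a' \<notin> fv M - {a}" "M' = M[a ::= Var a']"
proof -
  obtain b where b: "b \<notin> fv M - {a}" "b \<notin> fv M' - {a'}" "snd a = snd a'"
    "M[a ::= Var b] = M'[a' ::= Var b]"
    using Lam_eq_common_rename[OF assms] by blast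
  show "snd a = snd a'" by fact
  show "a' \<notin> fv M - {a}" using arg_cong[OF assms, of fv] by auto
  \<comment> \<open>Renaming to \<open>b\<close> and back recovers \<open>M'\<close>, and after the
    first renaming the two bodies coincide.\<close>
  have "M' = (M'[a' ::= Var b])[b ::= Var a']"
    by (simp only: subst_rename_subst[OF b(2)] subst_self)
  also have "\<dots> = M[a ::= Var a']"
    by (simp only: b(4)[symmetric] subst_rename_subst[OF b(1)])
  finally show "M' = M[a ::= Var a']" .
qed

lemma Lam_rename':
  fixes M :: "('v::infinite) trm"
  assumes "b \<notin> fv M - {a}" "snd b = snd a"
  shows "Lam a M = Lam b (M[a ::= Var b])"
  using psubst_Lam[where \<sigma> = Var and b = b and M = M and a = a] assms by (simp add: subst_eq_psubst psubst_id)

lemma ex_fresh_name: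
  assumes "finite (S :: ('v::infinite) ivar set)"
  obtains b where "fst b \<notin> fst ` S" "b \<notin> S" "snd b = L"
proof -
  have "finite (fst ` S)" using assms by simp
  then obtain z where "z \<notin> fst ` S" using ex_new_if_finite infinite_UNIV by blast
  then show thesis by (intro that[of "(z, L)"]) force+
qed


section \<open>Parallel reduction\<close>

text \<open>The flag \<open>e\<close> says whether eta-redexes may be contracted. Joinability and the order
  on degrees are dropped here: only the index condition on beta-redexes matters for the diamond
  property.\<close>

inductive par :: "bool \<Rightarrow> 'v trm \<Rightarrow> 'v trm \<Rightarrow> bool" for e where
  Var: "par e (Var a) (Var a)"
| App: "par e M M' \<Longrightarrow> par e N N' \<Longrightarrow> par e (App M N) (App M' N')"
| Lam: "par e M M' \<Longrightarrow> par e (Lam a M) (Lam a M')"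
| beta: "par e M M' \<Longrightarrow> par e N N' \<Longrightarrow> deg N = snd a \<Longrightarrow>
    par e (App (Lam a M) N) (M'[a ::= N'])"
| eta: "e \<Longrightarrow> par e M M' \<Longrightarrow> a \<notin> fv M \<Longrightarrow> par e (Lam a (App M (Var a))) M'"

lemma par_refl [simp]: "par e M M"
  by (induction M rule: trm_induct) (auto intro: par.intros)

lemma par_fv: "par e M M' \<Longrightarrow> fv M' \<subseteq> fv M"
  for M :: "('v::infinite) trm"
  by (induction rule: par.induct) (auto simp: fv_subst split: if_splits)

lemma par_deg: "par e M M' \<Longrightarrow> deg M' = deg M"
  by (induction rule: par.induct) (auto simp: deg_subst)

text \<open>Each binder is renamed apart from the range of \<open>\<sigma>\<close>. Reducts gain no
  free variables, so the same name is fresh for \<open>\<tau>\<close>. The hypothesis on degrees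
  preserves the index condition of beta-redexes.\<close>

lemma par_psubst:
  fixes M :: "('v::infinite) trm"
  assumes "par e M M'" "\<And>c. par e (\<sigma> c) (\<tau> c)" "\<And>c. deg (\<sigma> c) = snd c"
  shows "par e (psubst \<sigma> M) (psubst \<tau> M')"
  using assms
proof (induction arbitrary: \<sigma> \<tau> rule: par.induct)
  case (Lam M M' a)
  obtain b where b: "b \<notin> (\<Union>c \<in> fv M - {a}. fv (\<sigma> c))" "snd b = snd a"
    by (rule ex_fresh_name[of "\<Union>c \<in> fv M - {a}. fv (\<sigma> c)" "snd a"]) auto
  have b': "b \<notin> (\<Union>c \<in> fv M' - {a}. fv (\<tau> c))"
    using b(1) par_fv[OF Lam.hyps] par_fv[OF Lam.prems(1)] by blast
  have "par e (psubst (\<sigma>(a := Var b)) M) (psubst (\<tau>(a := Var b)) M')"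
    using Lam.prems b by (intro Lam.IH) auto
  then show ?case using b b' by (simp add: psubst_Lam[of b] par.Lam)
next
  case (beta M M' N N' a)
  obtain b where b: "b \<notin> (\<Union>c \<in> fv M - {a}. fv (\<sigma> c))" "snd b = snd a"
    by (rule ex_fresh_name[of "\<Union>c \<in> fv M - {a}. fv (\<sigma> c)" "snd a"]) auto
  have b': "b \<notin> (\<Union>c \<in> fv M' - {a}. fv (\<tau> c))"
    using b(1) par_fv[OF beta.hyps(1)] par_fv[OF beta.prems(1)] by blast
  have "par e (psubst (\<sigma>(a := Var b)) M) (psubst (\<tau>(a := Var b)) M')"
    using beta.prems b by (intro beta.IH) auto
  moreover have "par e (psubst \<sigma> N) (psubst \<tau> N')" using beta.prems by (intro beta.IH)
  moreover have "deg (psubst \<sigma> N) = snd b" using beta.prems beta.hyps b by (simp add: deg_psubst)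
  ultimately have "par e (App (Lam b (psubst (\<sigma>(a := Var b)) M)) (psubst \<sigma> N))
      ((psubst (\<tau>(a := Var b)) M')[b ::= psubst \<tau> N'])"
    by (rule par.beta)
  then show ?case using b by (simp add: psubst_Lam[of b] subst_psubst[OF b'] psubst_subst)
next
  case (eta M M' a)
  obtain b where b: "b \<notin> (\<Union>c \<in> fv M. fv (\<sigma> c))" "snd b = snd a"
    by (rule ex_fresh_name[of "\<Union>c \<in> fv M. fv (\<sigma> c)" "snd a"]) auto
  have "psubst (\<sigma>(a := Var b)) M = psubst \<sigma> M" using eta.hyps by (intro psubst_cong) auto
  moreover have "b \<notin> fv (psubst \<sigma> M)" using b by (simp add: fv_psubst)
  moreover have "par e (psubst \<sigma> M) (psubst \<tau> M')" using eta.prems by (intro eta.IH)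
  ultimately show ?case using b eta.hyps by (simp add: psubst_Lam[of b] par.eta)
qed (auto intro: par.intros)

lemma par_subst:
  fixes M :: "('v::infinite) trm"
  assumes "par e M M'" "par e N N'" "deg N = snd a"
  shows "par e (M[a ::= N]) (M'[a ::= N'])"
  unfolding subst_eq_psubst using assms by (intro par_psubst) auto

section \<open>Inversion of parallel reduction and the diamond property\<close>

lemma par_VarE:
  fixes Q :: "('v::infinite) trm"
  assumes "par e (Var a) Q" obtains "Q = Var a"
  using assms by cases auto

text \<open>Rule inversion yields an equal abstraction with its own binder. Renaming that binder to
  \<open>a\<close> substitutes a variable of the same index, which \<open>par_subst\<close>
  allows.\<close>

lemma par_LamE:
  fixes P :: "('v::infinite) trm"
  assumes "par e (Lam a P) Q"
  obtains (Lam) P' where "Q = Lam a P'" "par e P P'"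
  | (eta) R where "P = App R (Var a)" "a \<notin> fv R" "e" "par e R Q"
  using assms
proof cases
  case (Lam M M' b)
  note ren = Lam_eqD[OF Lam(1)[symmetric]]
  have "Lam b M' = Lam a (M'[b ::= Var a])"
    using ren par_fv[OF Lam(3)] by (intro Lam_rename') auto
  moreover have "par e P (M'[b ::= Var a])"
    unfolding ren(3) using ren(1) Lam(3) by (intro par_subst) auto
  ultimately show thesis using Lam that(1) by simp
next
  case (eta M b)
  note ren = Lam_eqD[OF eta(1)[symmetric]]
  have "a \<notin> fv M" using ren(2) eta by auto
  moreover have "P = App M (Var a)" using ren(3) eta by (simp add: subst_App subst_Var subst_fresh)
  ultimately show thesis using eta that(2) by blast
qed auto

lemma par_AppE:
  fixes P :: "('v::infinite) trm"
  assumes "par e (App P N) Q"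
  obtains (App) P' N' where "Q = App P' N'" "par e P P'" "par e N N'"
  | (beta) a R R' N' where "P = Lam a R" "Q = R'[a ::= N']" "par e R R'" "par e N N'" "deg N = snd a"
  using assms by cases (use that in auto)

lemma par_beta_LamE:
  fixes R :: "('v::infinite) trm"
  assumes "par e (App (Lam a R) N) Q"
  obtains (App) P' N' where "Q = App P' N'" "par e (Lam a R) P'" "par e N N'"
  | (beta) R' N' where "Q = R'[a ::= N']" "par e R R'" "par e N N'" "deg N = snd a"
  using assms
proof (cases rule: par_AppE)
  case (beta b S S' N')
  note ren = Lam_eqD[OF beta(1)[symmetric]]
  have "par e R (S'[b ::= Var a])"
    unfolding ren(3) using ren(1) beta by (intro par_subst) auto
  moreover have "(S'[b ::= Var a])[a ::= N'] = S'[b ::= N']"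
    using ren(2) par_fv[OF beta(3)] by (intro subst_rename_subst) auto
  ultimately show thesis using beta ren that(2) by metis
qed (use that in auto)

text \<open>Induction on size rather than on derivations: when beta and eta overlap, the hypothesis
  is applied to a subterm with a newly assembled parallel step, which need not occur in the given
  derivations.\<close>

lemma par_diamond:
  fixes M :: "('v::infinite) trm"
  assumes "par e M M1" "par e M M2"
  shows "\<exists>M3. par e M1 M3 \<and> par e M2 M3"
  using assms
proof (induction "tsize M" arbitrary: M M1 M2 rule: less_induct)
  case less
  \<comment> \<open>If \<open>R = \<lambda>b. S\<close> is contracted against \<open>a\<close>, then \<open>\<lambda>a. P1\<close> is just a reduct of \<open>R\<close>.\<close>
  have lam_eta: "\<exists>M3. par e (Lam a P1) M3 \<and> par e Q2 M3"
    if M: "M = Lam a (App R (Var a))" and a: "a \<notin> fv R" and e: "e" and Q2: "par e R Q2"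
      and P1: "par e (App R (Var a)) P1" for a R P1 Q2
    using P1
  proof (cases rule: par_AppE)
    case (App R1 V)
    then have "V = Var a" by (auto elim: par_VarE)
    obtain R3 where R3: "par e R1 R3" "par e Q2 R3"
      using less.hyps[of R R1 Q2] M Q2 App by auto
    have "a \<notin> fv R1" using par_fv[OF App(2)] a by auto
    then have "par e (Lam a P1) R3"
      using R3 App \<open>V = Var a\<close> e by (simp add: par.eta)
    then show ?thesis using R3 by blast
  next
    case (beta b S S1 V)
    then have V: "V = Var a" by (auto elim: par_VarE)
    have "Lam b S1 = Lam a P1"
      unfolding beta(2) V using par_fv[OF beta(3)] a beta by (intro Lam_rename') auto
    then have "par e R (Lam a P1)" using beta par.Lam by metis
    then show ?thesis using less.hyps[of R "Lam a P1" Q2] M Q2 by auto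
  qed
  \<comment> \<open>If \<open>\<lambda>a. R\<close> is an eta-redex, then \<open>P1 N1\<close> is an instance of \<open>P1 a\<close>, a reduct of \<open>R\<close>.\<close>
  have app_beta: "\<exists>M3. par e (App P1 N1) M3 \<and> par e (R2[a ::= N2]) M3"
    if M: "M = App (Lam a R) N" and P1: "par e (Lam a R) P1" and N: "par e N N1" "par e N N2"
      and R2: "par e R R2" and deg: "deg N = snd a" for a R N P1 N1 R2 N2
  proof -
    obtain N3 where N3: "par e N1 N3" "par e N2 N3" using less.hyps[of N N1 N2] M N by auto
    have d: "deg N1 = snd a" "deg N2 = snd a" using N deg par_deg by metis+
    show ?thesis using P1
    proof (cases rule: par_LamE)
      case (Lam R1)
      obtain R3 where "par e R1 R3" "par e R2 R3" using less.hyps[of R R1 R2] M Lam R2 by auto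
      then show ?thesis using Lam N3 d par.beta par_subst by metis
    next
      case (eta Q)
      have "par e R (App P1 (Var a))" using eta by (auto intro: par.intros)
      then obtain R3 where R3: "par e (App P1 (Var a)) R3" "par e R2 R3"
        using less.hyps[of R "App P1 (Var a)" R2] M R2 by auto
      have "a \<notin> fv P1" using par_fv[OF eta(4)] eta by auto
      then have "App P1 N1 = (App P1 (Var a))[a ::= N1]"
        by (simp add: subst_App subst_Var subst_fresh)
      then show ?thesis using R3 N3 d par_subst by metis
    qed
  qed
  show ?case
  proof (cases M rule: trm_cases)
    case (Var a)
    then show ?thesis using less.prems by (auto elim!: par_VarE intro: par_refl)
  next
    case (App P N)
    show ?thesis using less.prems(1)[unfolded App]
    proof (cases rule: par_AppE)
      case app1: (App P1 N1)
      show ?thesis using less.prems(2)[unfolded App]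
      proof (cases rule: par_AppE)
        case app2: (App P2 N2)
        obtain P3 where "par e P1 P3" "par e P2 P3" using less.hyps[of P P1 P2] App app1 app2 by auto
        moreover obtain N3 where "par e N1 N3" "par e N2 N3"
          using less.hyps[of N N1 N2] App app1 app2 by auto
        ultimately show ?thesis using app1 app2 par.App by metis
      next
        case (beta a R R2 N2)
        then show ?thesis using app_beta App app1 by simp
      qed
    next
      case beta1: (beta a R R1 N1)
      show ?thesis using less.prems(2)[unfolded App beta1(1)]
      proof (cases rule: par_beta_LamE)
        case (App P2 N2)
        then show ?thesis using app_beta[of a R N P2 N2 N1 R1] \<open>M = App P N\<close> beta1 by auto
      next
        case beta2: (beta R2 N2)
        obtain R3 where R3: "par e R1 R3" "par e R2 R3"
          using less.hyps[of R R1 R2] App beta1 beta2 by auto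
        obtain N3 where N3: "par e N1 N3" "par e N2 N3"
          using less.hyps[of N N1 N2] App beta1 beta2 by auto
        have "deg N1 = snd a" "deg N2 = snd a" using beta1 beta2 par_deg by metis+
        then show ?thesis using R3 N3 beta1 beta2 par_subst by metis
      qed
    qed
  next
    case (Lam a P)
    show ?thesis using less.prems(1)[unfolded Lam]
    proof (cases rule: par_LamE)
      case lam1: (Lam P1)
      show ?thesis using less.prems(2)[unfolded Lam]
      proof (cases rule: par_LamE)
        case lam2: (Lam P2)
        obtain P3 where "par e P1 P3" "par e P2 P3" using less.hyps[of P P1 P2] Lam lam1 lam2 by auto
        then show ?thesis using lam1 lam2 par.Lam by metis
      next
        case (eta R)
        then show ?thesis using lam_eta Lam lam1 by simp
      qed
    next
      case eta1: (eta R)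
      show ?thesis using less.prems(2)[unfolded Lam]
      proof (cases rule: par_LamE)
        case (Lam P2)
        then show ?thesis using lam_eta[of a R M1 P2] \<open>M = Lam a P\<close> eta1 by auto
      next
        case (eta R2)
        then show ?thesis using less.hyps[of R M1 M2] Lam eta1 by auto
      qed
    qed
  qed
qed

lemma par_confluent: "confluentp (par e :: ('v::infinite) trm \<Rightarrow> _)"
  by (intro strong_confluentp_imp_confluentp strong_confluentpI)
    (use par_diamond in \<open>blast intro: r_into_rtranclp\<close>)


section \<open>Closure properties of the set of terms\<close>

lemma joinable_iff: "M \<diamondop> N \<longleftrightarrow> (\<forall>c \<in> fv M. \<forall>d \<in> fv N. fst c = fst d \<longrightarrow> snd c = snd d)"
  unfolding joinable_def by force

lemma joinable_mono: "M \<diamondop> N \<Longrightarrow> fv M' \<subseteq> fv M \<Longrightarrow> fv N' \<subseteq> fv N \<Longrightarrow> M' \<diamondop> N'"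
  unfolding joinable_iff by blast

text \<open>Joinability is not reflexive on arbitrary expressions, but in a term the application
  rule compares the two sides, so a name never occurs free with two indexes.\<close>

lemma terms_self_joinable: "M \<in> \<M> \<Longrightarrow> M \<diamondop> M"
proof (induction rule: terms.induct)
  case (App M N)
  then show ?case unfolding joinable_iff fv_simps by (metis UnE)
qed (auto simp: joinable_iff)

lemma Var_in_terms [simp]: "Var a \<in> \<M>"
  using terms.Var[of "fst a" "snd a"] by simp

lemma Lam_in_terms: "M \<in> \<M> \<Longrightarrow> prefix (deg M) (snd a) \<Longrightarrow> Lam a M \<in> \<M>"
  using terms.Lam[of M "snd a" "fst a"] by simp

lemma App_in_terms_iff:
  "App M N \<in> \<M> \<longleftrightarrow> M \<in> \<M> \<and> N \<in> \<M> \<and> prefix (deg M) (deg N) \<and> M \<diamondop> N"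
  for M N :: "('v::infinite) trm"
  by (auto intro: terms.App elim: terms.cases)

lemma psubst_in_terms:
  fixes M :: "('v::infinite) trm"
  assumes "M \<in> \<M>" "\<And>c. c \<in> fv M \<Longrightarrow> \<sigma> c \<in> \<M> \<and> deg (\<sigma> c) = snd c"
    "\<And>c d. c \<in> fv M \<Longrightarrow> d \<in> fv M \<Longrightarrow> \<sigma> c \<diamondop> \<sigma> d"
  shows "psubst \<sigma> M \<in> \<M>"
  using assms
proof (induction arbitrary: \<sigma> rule: terms.induct)
  case (App M N)
  have "deg (psubst \<sigma> M) = deg M" "deg (psubst \<sigma> N) = deg N"
    using App.prems by (auto intro!: deg_psubst)
  moreover have "psubst \<sigma> M \<in> \<M>" "psubst \<sigma> N \<in> \<M>"
    using App.prems by (auto intro!: App.IH)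
  moreover have "psubst \<sigma> M \<diamondop> psubst \<sigma> N"
    unfolding joinable_iff fv_psubst
  proof (intro ballI impI)
    fix u v assume "u \<in> (\<Union>c \<in> fv M. fv (\<sigma> c))" "v \<in> (\<Union>c \<in> fv N. fv (\<sigma> c))" and eq: "fst u = fst v"
    then obtain c d where "c \<in> fv M" "d \<in> fv N" "u \<in> fv (\<sigma> c)" "v \<in> fv (\<sigma> d)" by blast
    then show "snd u = snd v" using App.prems(2)[of c d] eq by (auto simp: joinable_iff)
  qed
  ultimately show ?case using App.hyps by (simp add: terms.App)
next
  case (Lam M L x)
  let ?S = "\<Union>c \<in> fv M - {(x, L)}. fv (\<sigma> c)"
  \<comment> \<open>Freshness of the name, not only of the indexed variable, makes
    \<open>Var b\<close> joinable with every other substituted term.\<close>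
  obtain b where b: "fst b \<notin> fst ` ?S" "b \<notin> ?S" "snd b = L"
    by (rule ex_fresh_name[of ?S L]) auto
  have "psubst (\<sigma>((x, L) := Var b)) M \<in> \<M>"
  proof (rule Lam.IH)
    fix c d assume cd: "c \<in> fv M" "d \<in> fv M"
    have "fst u \<noteq> fst b" if "c \<in> fv M - {(x, L)}" "u \<in> fv (\<sigma> c)" for c u
      using b(1) that by (metis UN_I image_eqI)
    then have "\<sigma> c \<diamondop> Var b" "Var b \<diamondop> \<sigma> c" if "c \<in> fv M" "c \<noteq> (x, L)" for c
      unfolding joinable_iff fv_simps using that by (metis Diff_iff singletonD)+
    then show "(\<sigma>((x, L) := Var b)) c \<diamondop> (\<sigma>((x, L) := Var b)) d"
      using cd Lam.prems(2)[of c d] by (simp add: joinable_iff)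
  qed (use b Lam.prems in auto)
  moreover have "deg (psubst (\<sigma>((x, L) := Var b)) M) = deg M"
    using b Lam.prems by (intro deg_psubst) auto
  ultimately show ?case using b Lam.hyps by (simp add: psubst_Lam[of b] Lam_in_terms)
qed auto

text \<open>Joinability is required of the abstraction only: \<open>a\<close> is replaced, so a
  clash between \<open>a\<close> and a variable of \<open>N\<close> is harmless. This is what
  membership of a beta-redex supplies.\<close>

lemma subst_in_terms:
  fixes M :: "('v::infinite) trm"
  assumes "M \<in> \<M>" "N \<in> \<M>" "deg N = snd a" "Lam a M \<diamondop> N"
  shows "M[a ::= N] \<in> \<M>"
  unfolding subst_eq_psubst
proof (rule psubst_in_terms)
  fix c d assume cd: "c \<in> fv M" "d \<in> fv M"
  have "N \<diamondop> N" using assms(2) by (rule terms_self_joinable)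
  moreover have "Var c \<diamondop> Var d"
    using terms_self_joinable[OF assms(1)] cd unfolding joinable_iff fv_simps by blast
  moreover have "Var c \<diamondop> N" "N \<diamondop> Var c" if "c \<in> fv M" "c \<noteq> a" for c
    using assms(4) that unfolding joinable_iff fv_simps by (metis Diff_iff singletonD)+
  ultimately show "(Var(a := N)) c \<diamondop> (Var(a := N)) d" using cd by simp
qed (use assms in auto)

text \<open>Membership of an abstraction in \<open>\<M>\<close> does not pass to every body: \<open>\<lambda>x\<^sup>L. x\<^sup>K x\<^sup>L\<close> equals
  \<open>\<lambda>y\<^sup>L. x\<^sup>K y\<^sup>L\<close>, but for \<open>K \<noteq> L\<close> the body \<open>x\<^sup>K x\<^sup>L\<close> is not a term. The name of the bound variable has
  to be fresh, whatever its index.\<close>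

lemma Lam_in_termsD:
  fixes P :: "('v::infinite) trm"
  assumes "Lam a P \<in> \<M>"
  shows "prefix (deg P) (snd a)"
    and "fst b \<notin> fst ` fv P \<Longrightarrow> snd b = snd a \<Longrightarrow> P[a ::= Var b] \<in> \<M>"
proof -
  obtain x L Q where Q: "Lam a P = Lam (x, L) Q" "Q \<in> \<M>" "prefix (deg Q) L"
    using assms by cases auto
  note ren = Lam_eqD[OF Q(1)[symmetric]]
  show "prefix (deg P) (snd a)" using ren Q by (simp add: deg_subst)
  assume b: "fst b \<notin> fst ` fv P" "snd b = snd a"
  \<comment> \<open>\<open>Q\<close> is a body that is a term. Instantiating either body by the
    fresh \<open>b\<close> gives the same expression.\<close>
  have "P[a ::= Var b] = Q[(x, L) ::= Var b]"
    unfolding ren(3) using ren by (intro subst_rename_subst) auto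
  moreover have "fst b \<notin> fst ` (fv Q - {(x, L)})"
    using b(1) arg_cong[OF Q(1), of fv] by auto
  then have "Lam (x, L) Q \<diamondop> Var b"
    unfolding joinable_iff fv_simps by (metis image_eqI singletonD)
  then have "Q[(x, L) ::= Var b] \<in> \<M>"
    using b Q ren by (intro subst_in_terms) auto
  ultimately show "P[a ::= Var b] \<in> \<M>" by simp
qed

text \<open>\<open>P\<close> itself may lie outside \<open>\<M>\<close>, so the substitution passes
  through its instance at a fresh name, which is a term.\<close>

lemma beta_reduct_in_terms:
  fixes P N :: "('v::infinite) trm"
  assumes "App (Lam a P) N \<in> \<M>" "deg N = snd a"
  shows "P[a ::= N] \<in> \<M>"
proof -
  have N: "Lam a P \<in> \<M>" "N \<in> \<M>" "Lam a P \<diamondop> N" using assms(1) by (auto simp: App_in_terms_iff)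
  obtain b where b: "fst b \<notin> fst ` fv P" "b \<notin> fv P" "snd b = snd a"
    using ex_fresh_name[OF finite_fv] .
  have "Lam b (P[a ::= Var b]) \<diamondop> N" using N(3) b Lam_rename'[of b P a] by simp
  then have "(P[a ::= Var b])[b ::= N] \<in> \<M>"
    using b N(2) assms(2) Lam_in_termsD(2)[OF N(1)]
    by (intro subst_in_terms[of "P[a ::= Var b]"]) simp_all
  then show ?thesis using b by (simp add: subst_rename_subst)
qed

text \<open>Opening the body with a fresh name leaves \<open>R\<close> untouched, as
  \<open>a\<close> is not free in it, and \<open>R\<close> is then the left part of an application
  in \<open>\<M>\<close>.\<close>

lemma eta_reduct_in_terms:
  fixes R :: "('v::infinite) trm"
  assumes "Lam a (App R (Var a)) \<in> \<M>" "a \<notin> fv R"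
  shows "R \<in> \<M>"
proof -
  obtain b where b: "fst b \<notin> fst ` fv (App R (Var a))" "snd b = snd a"
    using ex_fresh_name[OF finite_fv] .
  have "(App R (Var a))[a ::= Var b] \<in> \<M>" using Lam_in_termsD(2)[OF assms(1) b] .
  then show ?thesis using assms by (simp add: subst_App subst_Var subst_fresh App_in_terms_iff)
qed


section \<open>Reduction on terms\<close>

text \<open>The flag matches that of \<open>par\<close>, so beta and beta-eta are treated
  together.\<close>

definition red :: "bool \<Rightarrow> 'v trm \<Rightarrow> 'v trm \<Rightarrow> bool" where
  "red e = (if e then beta_eta else beta)"

text \<open>The context rules carry membership of both sides as premises, so a case distinction
  suffices.\<close>

lemma compatible_closure_in_terms:
  assumes "compatible_closure R M N" "\<And>M N. R M N \<Longrightarrow> M \<in> \<M> \<and> N \<in> \<M>"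
  shows "M \<in> \<M> \<and> N \<in> \<M>"
  using assms(1) by cases (use assms(2) in auto)

lemma red_in_terms: "red e M N \<Longrightarrow> M \<in> \<M> \<and> N \<in> \<M>"
  for M N :: "('v::infinite) trm"
proof -
  have redex: "P \<in> \<M> \<and> Q \<in> \<M>" if "beta_redex P Q \<or> eta_redex P Q" for P Q :: "'v trm"
    using that by (auto elim!: beta_redex.cases eta_redex.cases
        intro: beta_reduct_in_terms eta_reduct_in_terms)
  assume "red e M N"
  then have "compatible_closure beta_redex M N \<or> compatible_closure eta_redex M N"
    by (auto simp: red_def beta_eta_def beta_def eta_def split: if_splits)
  then show "M \<in> \<M> \<and> N \<in> \<M>"
    by (elim disjE) (erule compatible_closure_in_terms, rule redex, blast)+
qed

lemma compatible_closure_le_par: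
  assumes "compatible_closure R M N" "\<And>M N. R M N \<Longrightarrow> par e M N"
  shows "par e M N"
  using assms(1) by (induction rule: compatible_closure.induct) (auto intro: par.intros assms(2))

lemma beta_le_par: "beta M N \<Longrightarrow> par e M N"
  unfolding beta_def
  by (erule compatible_closure_le_par) (auto elim!: beta_redex.cases intro: par.beta)

lemma red_le_par: "red e M N \<Longrightarrow> par e M N"
proof -
  have "par True M N" if "eta M N"
    using that unfolding eta_def
    by (rule compatible_closure_le_par) (auto elim!: eta_redex.cases intro: par.eta)
  then show "red e M N \<Longrightarrow> par e M N"
    unfolding red_def beta_eta_def by (cases e) (auto intro: beta_le_par)
qed

lemma red_Lam: "red e M N \<Longrightarrow> Lam a M \<in> \<M> \<Longrightarrow> Lam a N \<in> \<M> \<Longrightarrow> red e (Lam a M) (Lam a N)"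
  unfolding red_def beta_eta_def beta_def eta_def
  by (cases a) (auto split: if_splits intro: compatible_closure.lam)

lemma red_App_left:
  "red e M N \<Longrightarrow> App M P \<in> \<M> \<Longrightarrow> App N P \<in> \<M> \<Longrightarrow> red e (App M P) (App N P)"
  unfolding red_def beta_eta_def beta_def eta_def
  by (auto split: if_splits intro: compatible_closure.app_left)

lemma red_App_right:
  "red e M N \<Longrightarrow> App P M \<in> \<M> \<Longrightarrow> App P N \<in> \<M> \<Longrightarrow> red e (App P M) (App P N)"
  unfolding red_def beta_eta_def beta_def eta_def
  by (auto split: if_splits intro: compatible_closure.app_right)

text \<open>\<open>beta_redex\<close> wants the body joinable with the argument, which may fail for
  the given bound name. A name fresh for both repairs this without changing redex or
  contractum.\<close>

lemma red_beta:
  fixes P N :: "('v::infinite) trm"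
  assumes "App (Lam a P) N \<in> \<M>" "deg N = snd a"
  shows "red e (App (Lam a P) N) (P[a ::= N])"
proof -
  have N: "Lam a P \<diamondop> N" using assms(1) by (auto simp: App_in_terms_iff)
  have "finite (fv P \<union> fv N)" by simp
  then obtain b where b: "fst b \<notin> fst ` (fv P \<union> fv N)" "b \<notin> fv P \<union> fv N" "snd b = snd a"
    by (rule ex_fresh_name)
  have eq: "Lam a P = Lam b (P[a ::= Var b])" "(P[a ::= Var b])[b ::= N] = P[a ::= N]"
    using b Lam_rename'[of b P a] subst_rename_subst[of b P a N] by blast+
  have "fv (P[a ::= Var b]) \<subseteq> insert b (fv (Lam a P))" by (auto simp: fv_subst)
  moreover have "fst c \<noteq> fst b" if "c \<in> fv N" for c using b(1) that by (metis UnI2 image_eqI)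
  ultimately have "P[a ::= Var b] \<diamondop> N" using N unfolding joinable_iff by (metis insertE subsetD)
  then have "beta_redex (App (Lam b (P[a ::= Var b])) N) ((P[a ::= Var b])[b ::= N])"
    using beta_redex.intros[of "fst b" "snd b" "P[a ::= Var b]" N] assms b(3)
    unfolding prod.collapse eq(1) by metis
  then have "beta_redex (App (Lam a P) N) (P[a ::= N])" by (simp only: eq)
  then show ?thesis
    by (simp add: red_def beta_eta_def beta_def compatible_closure.base)
qed

lemma red_eta:
  assumes "Lam a (App R (Var a)) \<in> \<M>" "a \<notin> fv R"
  shows "red True (Lam a (App R (Var a))) R"
  using eta_redex.intros[of "fst a" "snd a" R] assms
  by (simp add: red_def beta_eta_def eta_def compatible_closure.base)

section \<open>Reduction sequences in contexts and simulation of parallel steps\<close>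

lemma red_Lam_in_terms:
  fixes M N :: "('v::infinite) trm"
  assumes "red e M N" "Lam a M \<in> \<M>"
  shows "Lam a N \<in> \<M>"
  using assms red_in_terms[OF assms(1)] par_deg[OF red_le_par[OF assms(1)]] Lam_in_termsD(1)[of a M]
  by (auto intro: Lam_in_terms)

lemma red_App_in_terms:
  fixes M N P :: "('v::infinite) trm"
  assumes "red e M N"
  shows "App M P \<in> \<M> \<Longrightarrow> App N P \<in> \<M>" "App P M \<in> \<M> \<Longrightarrow> App P N \<in> \<M>"
  using red_in_terms[OF assms] par_deg[OF red_le_par[OF assms]] par_fv[OF red_le_par[OF assms]]
    joinable_mono[of M P N P] joinable_mono[of P M P N]
  by (simp_all add: App_in_terms_iff)

text \<open>Membership is carried along as an invariant, because a step lifts to the context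
  \<open>F\<close> only when the enclosing expressions are terms.\<close>

lemma rtranclp_context:
  assumes "r\<^sup>*\<^sup>* M N" "F M \<in> \<M>"
    "\<And>M N. r M N \<Longrightarrow> F M \<in> \<M> \<Longrightarrow> F N \<in> \<M> \<and> r (F M) (F N)"
  shows "F N \<in> \<M> \<and> r\<^sup>*\<^sup>* (F M) (F N)"
  using assms(1,2)
  by (induction rule: rtranclp_induct)
    (auto intro: rtranclp.rtrancl_into_rtrancl dest: assms(3))

lemma reds_Lam:
  fixes M N :: "('v::infinite) trm"
  assumes "(red e)\<^sup>*\<^sup>* M N" "Lam a M \<in> \<M>"
  shows "(red e)\<^sup>*\<^sup>* (Lam a M) (Lam a N)"
  using rtranclp_context[OF assms(1), of "Lam a"] assms(2) red_Lam red_Lam_in_terms by blast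

lemma reds_App:
  fixes M N M' N' :: "('v::infinite) trm"
  assumes "(red e)\<^sup>*\<^sup>* M M'" "(red e)\<^sup>*\<^sup>* N N'" "App M N \<in> \<M>"
  shows "App M' N' \<in> \<M>" "(red e)\<^sup>*\<^sup>* (App M N) (App M' N')"
proof -
  have 1: "App M' N \<in> \<M> \<and> (red e)\<^sup>*\<^sup>* (App M N) (App M' N)"
    using assms(3) red_App_left red_App_in_terms(1)
    by (intro rtranclp_context[OF assms(1), of "\<lambda>X. App X N"]) blast+
  then have "App M' N' \<in> \<M> \<and> (red e)\<^sup>*\<^sup>* (App M' N) (App M' N')"
    using red_App_right red_App_in_terms(2)
    by (intro rtranclp_context[OF assms(2), of "App M'"]) blast+
  then show "App M' N' \<in> \<M>" "(red e)\<^sup>*\<^sup>* (App M N) (App M' N')" using 1 by auto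
qed

text \<open>The induction is on size rather than on the derivation, because the binder has to be
  renamed before the induction hypothesis applies to the body.\<close>

lemma par_le_reds:
  fixes M :: "('v::infinite) trm"
  assumes "par e M M'" "M \<in> \<M>"
  shows "(red e)\<^sup>*\<^sup>* M M'"
  using assms
proof (induction "tsize M" arbitrary: M M' rule: less_induct)
  case less
  have lam: "(red e)\<^sup>*\<^sup>* (Lam a P) (Lam a P')"
    if "par e P P'" "Lam a P \<in> \<M>" "tsize (Lam a P) \<le> tsize M" for a and P P' :: "'v trm"
  proof -
    have "fv P' \<subseteq> fv P" using that(1) by (rule par_fv)
    obtain b where b: "fst b \<notin> fst ` fv P" "b \<notin> fv P" "snd b = snd a"
      using ex_fresh_name[OF finite_fv] .
    have eq: "Lam a P = Lam b (P[a ::= Var b])" "Lam a P' = Lam b (P'[a ::= Var b])"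
      using b \<open>fv P' \<subseteq> fv P\<close> by (auto intro!: Lam_rename')
    \<comment> \<open>The renamed body is a term because the name of \<open>b\<close> is fresh, and
      it has the size of \<open>P\<close>, as comparing the sizes of the equal abstractions
      shows.\<close>
    have "(red e)\<^sup>*\<^sup>* (P[a ::= Var b]) (P'[a ::= Var b])"
      using that b arg_cong[OF eq(1), of tsize] Lam_in_termsD(2)[OF that(2), of b]
      by (intro less.hyps) (auto intro!: par_subst)
    then show ?thesis using that(2) unfolding eq by (rule reds_Lam)
  qed
  show ?case using less.prems(1)
  proof cases
    case (App P P' N N')
    have "(red e)\<^sup>*\<^sup>* P P'" "(red e)\<^sup>*\<^sup>* N N'"
      using App less.prems by (auto intro!: less.hyps simp: App_in_terms_iff)
    then show ?thesis using App less.prems by (simp add: reds_App)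
  next
    case (Lam P P' a)
    then show ?thesis using lam less.prems by simp
  next
    case (beta P P' N N' a)
    \<comment> \<open>Both parts of the redex are reduced first and the resulting redex is
      contracted last. Its degree condition survives by \<open>par_deg\<close>.\<close>
    have "(red e)\<^sup>*\<^sup>* (Lam a P) (Lam a P')" "(red e)\<^sup>*\<^sup>* N N'"
      using beta less.prems by (auto intro!: less.hyps lam simp: App_in_terms_iff)
    then have "App (Lam a P') N' \<in> \<M>" "(red e)\<^sup>*\<^sup>* M (App (Lam a P') N')"
      using beta less.prems by (simp_all add: reds_App)
    moreover have "deg N' = snd a" using beta par_deg by metis
    ultimately show ?thesis
      using beta red_beta by (metis rtranclp.rtrancl_into_rtrancl)
  next
    case (eta R a)
    have R: "R \<in> \<M>" using eta less.prems by (auto intro: eta_reduct_in_terms)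
    then have "(red e)\<^sup>*\<^sup>* R M'" using eta by (intro less.hyps) auto
    then show ?thesis
      using eta less.prems red_eta by (metis (full_types) converse_rtranclp_into_rtranclp)
  qed simp
qed

lemma reds_in_terms: "(red e)\<^sup>*\<^sup>* M N \<Longrightarrow> M \<in> \<M> \<Longrightarrow> N \<in> \<M>"
  for M N :: "('v::infinite) trm"
  by (induction rule: rtranclp_induct) (auto dest: red_in_terms)

lemma pars_le_reds:
  fixes M :: "('v::infinite) trm"
  assumes "(par e)\<^sup>*\<^sup>* M N" "M \<in> \<M>"
  shows "(red e)\<^sup>*\<^sup>* M N"
  using assms
proof (induction rule: rtranclp_induct)
  case (step N P)
  then show ?case using reds_in_terms par_le_reds by (meson rtranclp_trans)
qed simp

lemma red_confluent: "confluentp (red e :: ('v::infinite) trm \<Rightarrow> _)"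
proof (rule confluentpI)
  fix M M1 M2 :: "'v trm"
  assume reds: "(red e)\<^sup>*\<^sup>* M M1" "(red e)\<^sup>*\<^sup>* M M2"
  show "\<exists>M'. (red e)\<^sup>*\<^sup>* M1 M' \<and> (red e)\<^sup>*\<^sup>* M2 M'"
  \<comment> \<open>\<open>confluentp\<close> also speaks of expressions outside
    \<open>\<M>\<close>. These admit no step, so peaks there are trivial.\<close>
  proof (cases "M \<in> \<M>")
    case True
    have "(par e)\<^sup>*\<^sup>* M M1" "(par e)\<^sup>*\<^sup>* M M2"
      using reds by (metis mono_rtranclp red_le_par)+
    then show ?thesis
      using confluentpD[OF par_confluent] reds True reds_in_terms pars_le_reds by metis
  next
    case False
    then have "M1 = M" "M2 = M" using reds by (metis converse_rtranclpE red_in_terms)+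
    then show ?thesis by blast
  qed
qed


section \<open>Weak head reduction\<close>

text \<open>Arguments are peeled off from the right. The lengths must agree, since otherwise the
  abstraction at the head of one spine would equal an application.\<close>

lemma foldl_App_redex_inject:
  fixes M M' :: "('v::infinite) trm"
  assumes "foldl App (App (Lam a M) N) Ns = foldl App (App (Lam a' M') N') Ns'"
  shows "App (Lam a M) N = App (Lam a' M') N' \<and> Ns = Ns'"
proof -
  have not_Lam: "foldl App (App P Q) Ps \<noteq> Lam b R" for P Q Ps b and R :: "'v trm"
    by (cases Ps rule: rev_cases) auto
  show ?thesis using assms
  proof (induction Ns arbitrary: Ns' rule: rev_induct)
    case Nil
    then show ?case by (cases Ns' rule: rev_cases) (simp_all add: not_Lam[symmetric])
  next
    case step: (snoc P Ns)
    show ?case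
    proof (cases Ns' rule: rev_cases)
      case (snoc Ps R)
      then show ?thesis using step.IH[of Ps] step.prems by simp
    qed (use step.prems in \<open>simp add: not_Lam\<close>)
  qed
qed

lemma weak_head_deterministic:
  fixes M :: "('v::infinite) trm"
  assumes "weak_head M M1" "weak_head M M2"
  shows "M1 = M2"
  using assms(1)
proof cases
  case M1: (1 x L P N Ns)
  show ?thesis using assms(2)
  proof cases
    case M2: (1 x' L' P' N' Ns')
    have eq: "Lam (x, L) P = Lam (x', L') P'" "N = N'" "Ns = Ns'"
      using foldl_App_redex_inject[OF M1(1)[symmetric, unfolded M2(1), symmetric]] by simp_all
    \<comment> \<open>The two presentations of the redex may differ in the bound name, which does
      not affect the contractum.\<close>
    have "P'[(x', L') ::= N] = P[(x, L) ::= N]"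
      unfolding Lam_eqD(3)[OF eq(1)] using Lam_eqD(2)[OF eq(1)] by (rule subst_rename_subst)
    then show ?thesis unfolding M1(2) M2(2) eq(2,3) by simp
  qed
qed

lemma weak_head_confluent: "confluentp (weak_head :: ('v::infinite) trm \<Rightarrow> _)"
  by (intro strong_confluentp_imp_confluentp strong_confluentpI)
    (use weak_head_deterministic in blast)

text \<open>A weak head step is a beta step under further arguments, so membership is inherited from
  \<open>red_in_terms\<close>.\<close>

lemma weak_head_in_terms:
  fixes M N :: "('v::infinite) trm"
  assumes "weak_head M N"
  shows "M \<in> \<M> \<and> N \<in> \<M>"
proof -
  have step: "red False (foldl App (App (Lam a P) Q) Ns) (foldl App (P[a ::= Q]) Ns)"
    if "foldl App (App (Lam a P) Q) Ns \<in> \<M>" "deg Q = snd a" for a P Q and Ns :: "'v trm list"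
    using that
  proof (induction Ns rule: rev_induct)
    case (snoc R Ns)
    then have "red False (foldl App (App (Lam a P) Q) Ns) (foldl App (P[a ::= Q]) Ns)"
      by (simp add: App_in_terms_iff)
    then show ?case
      using snoc.prems(1) by (simp add: red_App_left red_App_in_terms(1))
  qed (simp add: red_beta)
  show ?thesis using assms
  proof cases
    case (1 x L P Q Ns)
    then show ?thesis using red_in_terms[OF step[of "(x, L)" P Q Ns]] by simp
  qed
qed


section \<open>Confluence and conversion\<close>

text \<open>The Church-Rosser form of confluence. As \<open>conv\<close> is generated by the closure
  of \<open>r\<close>, confluence is first transferred to that closure, whose own
  reflexive-transitive closure adds nothing.\<close>

lemma conv_iff_common_reduct:
  assumes "confluentp r"
  shows "conv r M N \<longleftrightarrow> (\<exists>P. r\<^sup>*\<^sup>* M P \<and> r\<^sup>*\<^sup>* N P)"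
proof -
  have "semiconfluentp (r\<^sup>*\<^sup>*)"
    using assms confluentp_conv_strong_confluentp_rtranclp strong_confluentp_into_semiconfluentp
    by blast
  then show ?thesis
    unfolding conv_def by (auto simp: semiconfluentp_equivclp rtranclp_conversep relcompp_apply)
qed

theorem theorem2:
  fixes M M1 M2 :: "('v :: {countable, infinite}) trm"
    and r :: "'v trm \<Rightarrow> 'v trm \<Rightarrow> bool"
  assumes "M \<in> \<M>" and "M1 \<in> \<M>" and "M2 \<in> \<M>"
    and "r \<in> {beta, beta_eta, weak_head}"
  shows "(r\<^sup>*\<^sup>* M M1 \<and> r\<^sup>*\<^sup>* M M2 \<longrightarrow> (\<exists>M' \<in> \<M>. r\<^sup>*\<^sup>* M1 M' \<and> r\<^sup>*\<^sup>* M2 M'))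
    \<and> (conv r M1 M2 \<longleftrightarrow> (\<exists>M \<in> \<M>. r\<^sup>*\<^sup>* M1 M \<and> r\<^sup>*\<^sup>* M2 M))"
proof -
  have r: "r = red False \<or> r = red True \<or> r = weak_head"
    using assms(4) by (auto simp: red_def)
  then have conf: "confluentp r" using red_confluent weak_head_confluent by blast
  have step: "N \<in> \<M>" if "r P N" for P N using r that red_in_terms weak_head_in_terms by blast
  \<comment> \<open>Confluence gives a common reduct among all expressions. Being reachable from
    \<open>M1\<close>, it lies in \<open>\<M>\<close>.\<close>
  have closed: "N \<in> \<M>" if "r\<^sup>*\<^sup>* M1 N" for N
    using that by (induction rule: rtranclp_induct) (auto intro: assms(2) step)
  show ?thesis
    using confluentpD[OF conf] conv_iff_common_reduct[OF conf] closed by blast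
qed

end
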